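(* Let $n\ge1$, let $K\subset\mathbb{R}^n$ be a compact set (not necessarily convex) and let $d$ be a positive even integer. Consider the two problems: $\mathbf{P}_0$: find a homogeneous polynomial $g$ of degree $d$ such that its sublevel set $G_1:=\{x\in\mathbb{R}^n: g(x)\le 1\}$ contains $K$ and has minimum volume among all such sublevel sets with this inclusion property; $$\mathcal{P}:\qquad \rho=\inf_{g\in H[x]_d}\left\{\int_{\mathbb{R}^n}\exp(-g(x))\,dx\;:\;1-g\in C_d(K)\right\}.$$ Then $\mathbf{P}_0$ has an optimal solution if and only if $\mathcal{P}$ has an optimal solution. Moreover, $\mathcal{P}$ is a finite-dimensional convex optimization problem (that is, it consists of minimizing a convex, possibly $+\infty$-valued, function over a convex subset of the finite-dimensional vector space $H[x]_d$).
   Context: $H[x]_d$ is the vector space of real homogeneous polynomials of degree $d$ in $x=(x_1,\ldots,x_n)$ (including $0$). $C_d(K)$ is the convex cone of real polynomials of degree at most $d$ that are nonnegative on $K$. Volume means Lebesgue measure on $\mathbb{R}^n$. An optimal solution is a feasible point attaining the minimum. *)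

theory Defs
  imports "HOL-Analysis.Analysis" "HOL-Analysis.Finite_Function_Topology"
begin

text \<open>
  A real polynomial in \<open>x\<^sub>i\<close>, \<open>i :: 'n\<close>, is the finitely supported family of its coefficients,
  indexed by exponent vectors. Its \<open>real_vector\<close> structure (\<open>+\<close>, \<open>*\<^sub>R\<close>) is the coefficientwise one,
  and \<open>1\<close> is the constant polynomial one.
\<close>

type_synonym 'n rpoly = "('n \<Rightarrow>\<^sub>0 nat) \<Rightarrow>\<^sub>0 real"

definition mon_degree :: "('n::finite \<Rightarrow>\<^sub>0 nat) \<Rightarrow> nat" where
  "mon_degree m = (\<Sum>i\<in>UNIV. Poly_Mapping.lookup m i)"

definition poly_eval :: "'n::finite rpoly \<Rightarrow> real ^ 'n \<Rightarrow> real" where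
  "poly_eval p x =
     (\<Sum>m\<in>Poly_Mapping.keys p. Poly_Mapping.lookup p m * (\<Prod>i\<in>UNIV. (x $ i) ^ Poly_Mapping.lookup m i))"

definition hom_polys :: "nat \<Rightarrow> 'n::finite rpoly set" where
  "hom_polys d = {g. \<forall>m\<in>Poly_Mapping.keys g. mon_degree m = d}"

definition nonneg_polys :: "nat \<Rightarrow> (real ^ 'n::finite) set \<Rightarrow> 'n rpoly set" where
  "nonneg_polys d K =
     {p. (\<forall>m\<in>Poly_Mapping.keys p. mon_degree m \<le> d) \<and> (\<forall>x\<in>K. 0 \<le> poly_eval p x)}"

definition sublevel :: "'n::finite rpoly \<Rightarrow> (real ^ 'n) set" where
  "sublevel g = {x. poly_eval g x \<le> 1}"

definition optimal_solution :: "('a \<Rightarrow> ennreal) \<Rightarrow> 'a set \<Rightarrow> 'a \<Rightarrow> bool" where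
  "optimal_solution f S g \<longleftrightarrow> g \<in> S \<and> f g = (INF h\<in>S. f h)"

definition P0_feasible :: "nat \<Rightarrow> (real ^ 'n::finite) set \<Rightarrow> 'n rpoly set" where
  "P0_feasible d K = {g \<in> hom_polys d. K \<subseteq> sublevel g}"

definition P0_objective :: "'n::finite rpoly \<Rightarrow> ennreal" where
  "P0_objective g = emeasure lebesgue (sublevel g)"

definition P_feasible :: "nat \<Rightarrow> (real ^ 'n::finite) set \<Rightarrow> 'n rpoly set" where
  "P_feasible d K = {g \<in> hom_polys d. 1 - g \<in> nonneg_polys d K}"

definition P_objective :: "'n::finite rpoly \<Rightarrow> ennreal" where
  "P_objective g = (\<integral>\<^sup>+ x. ennreal (exp (- poly_eval g x)) \<partial>lebesgue)"

text \<open>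
  The library's \<open>convex_on\<close> only covers real-valued functions. The weights are taken in the open
  interval, so the convention \<open>0 * \<infinity> = 0\<close> plays no role.
\<close>

definition ext_convex_on :: "'a::real_vector set \<Rightarrow> ('a \<Rightarrow> ennreal) \<Rightarrow> bool" where
  "ext_convex_on S f \<longleftrightarrow> convex S \<and>
     (\<forall>x\<in>S. \<forall>y\<in>S. \<forall>u>0. \<forall>v>0. u + v = 1 \<longrightarrow>
        f (u *\<^sub>R x + v *\<^sub>R y) \<le> ennreal u * f x + ennreal v * f y)"

definition finite_dim_convex_problem ::
  "'a::real_vector set \<Rightarrow> ('a \<Rightarrow> ennreal) \<Rightarrow> 'a set \<Rightarrow> bool" where
  "finite_dim_convex_problem V f S \<longleftrightarrow>
     subspace V \<and> (\<exists>B. finite B \<and> V = span B) \<and>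
     S \<subseteq> V \<and> convex S \<and> ext_convex_on V f"

end

theory Submission
  imports Defs
begin

text \<open>
  Everything rests on one identity: for a homogeneous \<open>g\<close> of degree \<open>d > 0\<close> in \<open>n\<close> variables,
    \<open>\<integral> exp (- g) = \<Gamma>(1 + n / d) * vol {g \<le> 1}\<close>,
  where both sides may be infinite. Writing \<open>exp (- g x)\<close> as the integral of \<open>exp (- t)\<close> over
  \<open>t \<ge> g x\<close> and exchanging integrals expresses the left-hand side through the volumes of the sets
  \<open>{g \<le> t}\<close> (\<open>nn_integral_exp_minus_layer_cake\<close>). For \<open>t > 0\<close> such a set is a dilate of
  \<open>{g \<le> 1}\<close>, with volume \<open>t powr (n / d) * vol {g \<le> 1}\<close> (\<open>emeasure_sublevel_homogeneous\<close>), and the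
  remaining integral over \<open>t > 0\<close> is Euler's integral for \<open>\<Gamma>\<close>. Since \<open>g\<close> may take
  negative values, the levels \<open>t \<le> 0\<close> occur as well: if \<open>vol {g \<le> 1}\<close> is finite, they contribute
  nothing, and if it is infinite, the levels \<open>t > 0\<close> alone make the integral diverge
  (\<open>nn_integral_exp_minus_homogeneous\<close>).

  Nonnegativity of \<open>1 - g\<close> on \<open>K\<close> says exactly that \<open>K\<close> lies in \<open>{g \<le> 1}\<close>, so the two problems
  have the same feasible set and objectives that differ by a positive finite constant. They therefore
  have the same optimal solutions. The objective of the second problem
  is convex because \<open>g \<mapsto> exp (- g x)\<close> is convex for each \<open>x\<close>, as the exponential function composed
  with a linear one.
\<close>

section \<open>Sublevel sets of homogeneous functions\<close>

text \<open>Tonelli's theorem applied to \<open>exp (- t)\<close> on the region \<open>f x \<le> t\<close>.\<close>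

lemma (in sigma_finite_measure) nn_integral_exp_minus_layer_cake:
  fixes f :: "'a \<Rightarrow> real"
  assumes [measurable]: "f \<in> borel_measurable M"
  shows "(\<integral>\<^sup>+ x. ennreal (exp (- f x)) \<partial>M) =
         (\<integral>\<^sup>+ t. ennreal (exp (- t)) * emeasure M {x \<in> space M. f x \<le> t} \<partial>lborel)"
proof -
  interpret pair_sigma_finite M lborel ..
  have "ennreal (exp (- f x)) =
        (\<integral>\<^sup>+ t. ennreal (exp (- t)) * indicator {f x..} t \<partial>lborel)" for x
    using nn_integral_has_integral_lebesgue'[OF _ has_integral_exp_minus_to_infinity[of 1 "f x"]]
    by simp
  then have "(\<integral>\<^sup>+ x. ennreal (exp (- f x)) \<partial>M) =
      (\<integral>\<^sup>+ x. \<integral>\<^sup>+ t. ennreal (exp (- t)) * indicator {f x..} t \<partial>lborel \<partial>M)"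
    by simp
  also have "\<dots> = (\<integral>\<^sup>+ t. \<integral>\<^sup>+ x. ennreal (exp (- t)) * indicator {f x..} t \<partial>M \<partial>lborel)"
  proof (rule Fubini'[symmetric])
    show "(\<lambda>(x, t). ennreal (exp (- t)) * indicator {f x..} t) \<in> borel_measurable (M \<Otimes>\<^sub>M lborel)"
      unfolding indicator_def atLeast_iff split_beta by measurable
  qed
  also have "\<dots> = (\<integral>\<^sup>+ t. ennreal (exp (- t)) * emeasure M {x \<in> space M. f x \<le> t} \<partial>lborel)"
  proof (rule nn_integral_cong)
    fix t :: real
    have "(\<integral>\<^sup>+ x. ennreal (exp (- t)) * indicator {f x..} t \<partial>M) =
          (\<integral>\<^sup>+ x. ennreal (exp (- t)) * indicator {x \<in> space M. f x \<le> t} x \<partial>M)"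
      by (intro nn_integral_cong) (auto simp: indicator_def)
    then show "(\<integral>\<^sup>+ x. ennreal (exp (- t)) * indicator {f x..} t \<partial>M) =
          ennreal (exp (- t)) * emeasure M {x \<in> space M. f x \<le> t}"
      by (simp add: nn_integral_cmult_indicator)
  qed
  finally show ?thesis .
qed

text \<open>
  The dilation by \<open>t powr (1 / d)\<close> multiplies the values of \<open>f\<close> by \<open>t\<close>, so it maps the sublevel set
  at \<open>1\<close> onto the one at \<open>t\<close>.
\<close>

lemma emeasure_sublevel_homogeneous:
  fixes f :: "'a::euclidean_space \<Rightarrow> real"
  assumes hom: "\<And>r x. r > 0 \<Longrightarrow> f (r *\<^sub>R x) = r ^ d * f x"
    and "d > 0" and "t > 0"
  shows "emeasure lebesgue {x. f x \<le> t} =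
         ennreal (t powr (DIM('a) / d)) * emeasure lebesgue {x. f x \<le> 1}"
proof -
  define r where "r = t powr (1 / d)"
  have "r > 0" using \<open>t > 0\<close> by (simp add: r_def)
  have rd: "r ^ d = t" and rn: "r ^ DIM('a) = t powr (DIM('a) / d)"
    using \<open>d > 0\<close> \<open>t > 0\<close> by (simp_all add: r_def powr_powr flip: powr_realpow)
  have scale: "f (r *\<^sub>R x) \<le> t \<longleftrightarrow> f x \<le> 1" for x
    using \<open>t > 0\<close> by (simp add: hom[OF \<open>r > 0\<close>] rd)
  have "{x. f x \<le> t} = (\<lambda>x. r *\<^sub>R x + 0) ` {x. f x \<le> 1}"
  proof (intro set_eqI iffI)
    fix x assume "x \<in> {x. f x \<le> t}"
    then have "(1 / r) *\<^sub>R x \<in> {x. f x \<le> 1}"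
      using \<open>r > 0\<close> by (simp flip: scale)
    moreover have "x = r *\<^sub>R ((1 / r) *\<^sub>R x) + 0" using \<open>r > 0\<close> by simp
    ultimately show "x \<in> (\<lambda>x. r *\<^sub>R x + 0) ` {x. f x \<le> 1}" by blast
  qed (auto simp: scale)
  then show ?thesis
    using \<open>r > 0\<close> by (simp only: emeasure_lebesgue_affine) (simp add: rn)
qed

text \<open>
  The set lies in every \<open>{f \<le> t}\<close> with \<open>t > 0\<close>, and the volume of these tends to \<open>0\<close> with \<open>t\<close> by
  the scaling formula.
\<close>

lemma null_nonpos_homogeneous:
  fixes f :: "'a::euclidean_space \<Rightarrow> real"
  assumes hom: "\<And>r x. r > 0 \<Longrightarrow> f (r *\<^sub>R x) = r ^ d * f x"
    and [measurable]: "f \<in> borel_measurable borel"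
    and "d > 0" and fin: "emeasure lebesgue {x. f x \<le> 1} < \<infinity>"
  shows "emeasure lebesgue {x. f x \<le> 0} = 0"
proof -
  let ?v = "measure lebesgue {x. f x \<le> 1}"
  have v: "emeasure lebesgue {x. f x \<le> 1} = ennreal ?v"
    using fin by (simp add: emeasure_eq_ennreal_measure less_top)
  have "((\<lambda>t::real. t powr (DIM('a) / d) * ?v) \<longlongrightarrow> 0 powr (DIM('a) / d) * ?v) (at_right 0)"
    using \<open>d > 0\<close> by (intro tendsto_intros tendsto_powr') (auto simp: eventually_at_filter)
  then have lim: "((\<lambda>t::real. ennreal (t powr (DIM('a) / d) * ?v)) \<longlongrightarrow> ennreal 0) (at_right 0)"
    by (intro tendsto_ennrealI) simp
  have "emeasure lebesgue {x. f x \<le> 0} \<le> ennreal 0"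
  proof (rule tendsto_lowerbound[OF lim])
    show "\<forall>\<^sub>F t in at_right 0. emeasure lebesgue {x. f x \<le> 0} \<le>
            ennreal (t powr (DIM('a) / d) * ?v)"
    proof (rule eventually_at_right_less[THEN eventually_mono])
      fix t :: real assume "0 < t"
      have "emeasure lebesgue {x. f x \<le> 0} \<le> emeasure lebesgue {x. f x \<le> t}"
        using \<open>0 < t\<close> by (intro emeasure_mono) auto
      also have "\<dots> = ennreal (t powr (DIM('a) / d) * ?v)"
        by (simp only: emeasure_sublevel_homogeneous[OF hom \<open>d > 0\<close> \<open>0 < t\<close>] v)
          (simp add: ennreal_mult)
      finally show "emeasure lebesgue {x. f x \<le> 0} \<le> ennreal (t powr (DIM('a) / d) * ?v)" .
    qed
  qed simp
  then show ?thesis by simp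
qed

text \<open>
  The layer cake formula turns the integral into one over all levels \<open>t\<close>, in which the levels
  \<open>t > 0\<close> make up Euler's integral times the volume of the unit sublevel set. The levels
  \<open>t \<le> 0\<close> add nothing to this: they have volume \<open>0\<close> if the unit sublevel set has finite volume,
  and otherwise the levels \<open>t > 0\<close> already give \<open>\<infinity>\<close>.
\<close>

lemma nn_integral_exp_minus_homogeneous:
  fixes f :: "'a::euclidean_space \<Rightarrow> real"
  assumes hom: "\<And>r x. r > 0 \<Longrightarrow> f (r *\<^sub>R x) = r ^ d * f x"
    and [measurable]: "f \<in> borel_measurable borel"
    and "d > 0"
  shows "(\<integral>\<^sup>+ x. ennreal (exp (- f x)) \<partial>lebesgue) =
         ennreal (Gamma (1 + DIM('a) / d)) * emeasure lebesgue {x. f x \<le> 1}"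
proof -
  let ?a = "DIM('a) / d" and ?V = "emeasure lebesgue {x. f x \<le> 1}"
  let ?w = "\<lambda>t::real. ennreal (indicator {0..} t * t powr ?a / exp t)"
  have "0 < Gamma (1 + ?a)"
    by (intro Gamma_real_pos add_pos_nonneg) simp_all
  have Gamma: "ennreal (Gamma (1 + ?a)) = (\<integral>\<^sup>+ t. ?w t \<partial>lborel)"
    using Gamma_conv_nn_integral_real[of "1 + ?a"] by (simp add: add_pos_nonneg)
  have pos: "?w t * ?V = ennreal (exp (- t)) * emeasure lebesgue {x. f x \<le> t}" if "t > 0" for t
    using that emeasure_sublevel_homogeneous[OF hom \<open>d > 0\<close> that]
    by (simp add: exp_minus divide_inverse ennreal_mult mult_ac)
  have const: "(\<integral>\<^sup>+ t. ?w t * ?V \<partial>lborel) = ennreal (Gamma (1 + ?a)) * ?V"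
    unfolding Gamma by (rule nn_integral_multc) measurable
  have "(\<integral>\<^sup>+ x. ennreal (exp (- f x)) \<partial>lebesgue) =
        (\<integral>\<^sup>+ t. ennreal (exp (- t)) * emeasure lebesgue {x. f x \<le> t} \<partial>lborel)"
    using lborel.nn_integral_exp_minus_layer_cake[of f] by (simp add: nn_integral_completion)
  also have "\<dots> = (\<integral>\<^sup>+ t. ?w t * ?V \<partial>lborel)"
  proof (cases "?V = \<infinity>")
    case False
    have null: "emeasure lebesgue {x. f x \<le> t} = 0" if "t \<le> 0" for t
    proof -
      have "emeasure lebesgue {x. f x \<le> t} \<le> emeasure lebesgue {x. f x \<le> 0}"
        using that by (intro emeasure_mono) auto
      then show ?thesis
        using null_nonpos_homogeneous[OF hom _ \<open>d > 0\<close>] False by (simp add: less_top)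
    qed
    show ?thesis
    proof (rule nn_integral_cong)
      fix t :: real
      show "ennreal (exp (- t)) * emeasure lebesgue {x. f x \<le> t} = ?w t * ?V"
      proof (cases "t > 0")
        case True
        then show ?thesis by (simp only: pos)
      next
        case False
        then show ?thesis using null[of t] by (cases "t = 0") auto
      qed
    qed
  next
    case True
    have "(\<integral>\<^sup>+ t. ?w t * ?V \<partial>lborel) \<le>
          (\<integral>\<^sup>+ t. ennreal (exp (- t)) * emeasure lebesgue {x. f x \<le> t} \<partial>lborel)"
    proof (rule nn_integral_mono)
      fix t :: real
      show "?w t * ?V \<le> ennreal (exp (- t)) * emeasure lebesgue {x. f x \<le> t}"
      proof (cases "t > 0")
        case True
        then show ?thesis by (simp only: pos order_refl)
      next
        case False
        then show ?thesis by (cases "t = 0") auto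
      qed
    qed
    \<comment> \<open>This needs the Gamma factor to be nonzero: in \<open>ennreal\<close>, \<open>0 * \<infinity> = 0\<close>.\<close>
    moreover have "(\<integral>\<^sup>+ t. ?w t * ?V \<partial>lborel) = \<infinity>"
      unfolding const using True \<open>0 < Gamma (1 + ?a)\<close> by (simp add: ennreal_mult_top)
    ultimately show ?thesis by (simp add: top_unique)
  qed
  also have "\<dots> = ennreal (Gamma (1 + ?a)) * ?V"
    by (fact const)
  finally show ?thesis .
qed

section \<open>Polynomials\<close>

lemma lookup_scaleR:
  "Poly_Mapping.lookup (c *\<^sub>R p) m = c *\<^sub>R Poly_Mapping.lookup p m"
proof -
  have "finite {i. c *\<^sub>R Poly_Mapping.lookup p i \<noteq> 0}"
    by (rule finite_subset[OF _ finite_keys[of p]]) (auto simp: in_keys_iff)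
  then show ?thesis by (simp add: scaleR_poly_mapping_def)
qed

text \<open>
  Summing over any finite set containing the support lets polynomials with different supports be
  evaluated over a common index set, which makes the linearity of \<open>poly_eval\<close> visible.
\<close>

lemma poly_eval_superset:
  assumes "finite A" and "Poly_Mapping.keys p \<subseteq> A"
  shows "poly_eval p x =
    (\<Sum>m\<in>A. Poly_Mapping.lookup p m * (\<Prod>i\<in>UNIV. (x $ i) ^ Poly_Mapping.lookup m i))"
  unfolding poly_eval_def
  by (rule sum.mono_neutral_left) (use assms in \<open>auto simp: in_keys_iff\<close>)

lemma poly_eval_add: "poly_eval (p + q) x = poly_eval p x + poly_eval q x"
proof -
  let ?A = "Poly_Mapping.keys p \<union> Poly_Mapping.keys q"
  have "Poly_Mapping.keys (p + q) \<subseteq> ?A" by (rule keys_add)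
  then show ?thesis
    by (simp add: poly_eval_superset[of ?A] lookup_add algebra_simps sum.distrib)
qed

lemma poly_eval_scaleR: "poly_eval (c *\<^sub>R p) x = c * poly_eval p x"
proof -
  have "Poly_Mapping.keys (c *\<^sub>R p) \<subseteq> Poly_Mapping.keys p"
    by (auto simp: in_keys_iff lookup_scaleR)
  then show ?thesis
    by (simp add: poly_eval_superset[of "Poly_Mapping.keys p"] lookup_scaleR sum_distrib_left mult_ac)
qed

lemma poly_eval_one: "poly_eval 1 x = 1"
  by (simp add: poly_eval_def)

lemma poly_eval_diff: "poly_eval (p - q) x = poly_eval p x - poly_eval q x"
  using poly_eval_add[of "p - q" q x] by simp

lemma borel_measurable_poly_eval [measurable]: "poly_eval p \<in> borel_measurable borel"
  unfolding poly_eval_def[abs_def] by (intro borel_measurable_continuous_onI continuous_intros)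

lemma poly_eval_homogeneous:
  assumes "g \<in> hom_polys d"
  shows "poly_eval g (r *\<^sub>R x) = r ^ d * poly_eval g x"
proof -
  have "(\<Prod>i\<in>UNIV. (r *\<^sub>R x) $ i ^ Poly_Mapping.lookup m i) =
        r ^ d * (\<Prod>i\<in>UNIV. x $ i ^ Poly_Mapping.lookup m i)"
    if "m \<in> Poly_Mapping.keys g" for m
    using assms that
    by (simp add: hom_polys_def mon_degree_def power_mult_distrib prod.distrib flip: power_sum)
  then show ?thesis
    unfolding poly_eval_def sum_distrib_left by (intro sum.cong) (simp_all add: mult_ac)
qed

text \<open>Each exponent is bounded by the total degree.\<close>

lemma finite_mon_degree: "finite {m :: 'n::finite \<Rightarrow>\<^sub>0 nat. mon_degree m = d}"
proof (rule finite_imageD)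
  have "Poly_Mapping.lookup m i \<le> mon_degree m" for m :: "'n \<Rightarrow>\<^sub>0 nat" and i
    unfolding mon_degree_def by (rule member_le_sum) auto
  then have "Poly_Mapping.lookup ` {m :: 'n \<Rightarrow>\<^sub>0 nat. mon_degree m = d} \<subseteq> (UNIV \<rightarrow>\<^sub>E {..d})"
    by (auto simp: PiE_def)
  then show "finite (Poly_Mapping.lookup ` {m :: 'n \<Rightarrow>\<^sub>0 nat. mon_degree m = d})"
    by (rule finite_subset) (simp add: finite_PiE)
qed (simp add: inj_on_def lookup_inject)

lemma subspace_hom_polys: "subspace (hom_polys d)"
  unfolding subspace_def hom_polys_def
  by (auto simp: in_keys_iff lookup_add lookup_scaleR)

lemma hom_polys_eq_span:
  "hom_polys d = span ((\<lambda>m. Poly_Mapping.single m 1) ` {m :: 'n::finite \<Rightarrow>\<^sub>0 nat. mon_degree m = d})"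
    (is "_ = span ?B")
proof
  show "span ?B \<subseteq> hom_polys d"
    by (rule span_minimal[OF _ subspace_hom_polys]) (auto simp: hom_polys_def)
  show "hom_polys d \<subseteq> span ?B"
  proof
    fix g :: "'n rpoly" assume g: "g \<in> hom_polys d"
    have "g = (\<Sum>m\<in>Poly_Mapping.keys g. Poly_Mapping.lookup g m *\<^sub>R Poly_Mapping.single m 1)"
      by (rule poly_mapping_eqI)
        (simp add: lookup_sum lookup_scaleR lookup_single when_def in_keys_iff
          if_distrib[of "(*) _"] cong: if_cong)
    also have "\<dots> \<in> span ?B"
      using g by (intro span_sum span_scale span_base) (auto simp: hom_polys_def)
    finally show "g \<in> span ?B" .
  qed
qed

section \<open>The two problems\<close>

text \<open>
  The monomials of \<open>1 - g\<close> are among those of \<open>g\<close> and the constant one, so its degree is at most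
  \<open>d\<close>, and its nonnegativity on \<open>K\<close> is the bound \<open>g \<le> 1\<close> there.
\<close>

lemma one_minus_mem_nonneg_polys_iff:
  assumes "g \<in> hom_polys d"
  shows "1 - g \<in> nonneg_polys d K \<longleftrightarrow> K \<subseteq> sublevel g"
proof -
  have "mon_degree m \<le> d" if "m \<in> Poly_Mapping.keys (1 - g)" for m
  proof -
    have "m = 0 \<or> m \<in> Poly_Mapping.keys g"
      using that by (auto simp: in_keys_iff lookup_minus lookup_one when_def split: if_splits)
    then show ?thesis using assms by (auto simp: hom_polys_def mon_degree_def)
  qed
  then show ?thesis
    by (auto simp: nonneg_polys_def sublevel_def poly_eval_diff poly_eval_one)
qed

lemma P_feasible_eq_P0_feasible: "P_feasible d K = P0_feasible d K"
  by (auto simp: P_feasible_def P0_feasible_def one_minus_mem_nonneg_polys_iff)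

lemma P_objective_eq_Gamma_times_P0_objective:
  fixes g :: "'n::finite rpoly"
  assumes "g \<in> hom_polys d" and "d > 0"
  shows "P_objective g = ennreal (Gamma (1 + CARD('n) / d)) * P0_objective g"
  unfolding P_objective_def P0_objective_def sublevel_def
  using nn_integral_exp_minus_homogeneous[of "poly_eval g" d] poly_eval_homogeneous[OF assms(1)] assms(2)
  by simp

lemma optimal_solution_iff_le:
  "optimal_solution f S g \<longleftrightarrow> g \<in> S \<and> (\<forall>h\<in>S. f g \<le> f h)"
proof -
  have "f g = (INF h\<in>S. f h) \<longleftrightarrow> (\<forall>h\<in>S. f g \<le> f h)" if "g \<in> S"
    using INF_lower[OF that, of f] by (auto simp: order.eq_iff le_INF_iff)
  then show ?thesis by (auto simp: optimal_solution_def)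
qed

lemma optimal_solution_cmult:
  assumes "0 < c" and "\<And>g. g \<in> S \<Longrightarrow> F g = ennreal c * f g"
  shows "optimal_solution F S g \<longleftrightarrow> optimal_solution f S g"
  using assms by (auto simp: optimal_solution_iff_le ennreal_mult_le_mult_iff)

text \<open>Jensen's inequality for \<open>exp\<close> at each point, integrated.\<close>

lemma ext_convex_on_P_objective:
  fixes S :: "'n::finite rpoly set"
  assumes "convex S"
  shows "ext_convex_on S P_objective"
  unfolding ext_convex_on_def
proof (intro conjI ballI allI impI)
  fix p q :: "'n rpoly" and u v :: real
  assume uv: "u > 0" "v > 0" "u + v = 1"
  let ?e = "\<lambda>p x. ennreal (exp (- poly_eval p x))"
  have "?e (u *\<^sub>R p + v *\<^sub>R q) x \<le> ennreal u * ?e p x + ennreal v * ?e q x" for x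
  proof -
    have "exp (u *\<^sub>R (- poly_eval p x) + v *\<^sub>R (- poly_eval q x)) \<le>
          u * exp (- poly_eval p x) + v * exp (- poly_eval q x)"
      using exp_convex uv unfolding convex_on_def by (meson UNIV_I less_imp_le)
    then show ?thesis
      using uv by (simp add: poly_eval_add poly_eval_scaleR flip: ennreal_mult ennreal_plus)
  qed
  then have "P_objective (u *\<^sub>R p + v *\<^sub>R q) \<le>
      (\<integral>\<^sup>+ x. ennreal u * ?e p x + ennreal v * ?e q x \<partial>lborel)"
    unfolding P_objective_def nn_integral_completion by (intro nn_integral_mono)
  also have "\<dots> = ennreal u * P_objective p + ennreal v * P_objective q"
    by (simp add: P_objective_def nn_integral_completion nn_integral_add nn_integral_cmult)
  finally show "P_objective (u *\<^sub>R p + v *\<^sub>R q) \<le>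
      ennreal u * P_objective p + ennreal v * P_objective q" .
qed fact

lemma convex_P0_feasible:
  fixes K :: "(real ^ 'n::finite) set"
  shows "convex (P0_feasible d K)"
proof (rule convexI)
  fix p q :: "'n rpoly" and u v :: real
  assume pq: "p \<in> P0_feasible d K" "q \<in> P0_feasible d K" and uv: "0 \<le> u" "0 \<le> v" "u + v = 1"
  have "poly_eval (u *\<^sub>R p + v *\<^sub>R q) x \<le> 1" if "x \<in> K" for x
    using pq uv that convex_bound_le[of "poly_eval p x" 1 "poly_eval q x" u v]
    by (auto simp: P0_feasible_def sublevel_def poly_eval_add poly_eval_scaleR)
  moreover have "u *\<^sub>R p + v *\<^sub>R q \<in> hom_polys d"
    using pq by (auto simp: P0_feasible_def intro!: subspace_add subspace_scale subspace_hom_polys)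
  ultimately show "u *\<^sub>R p + v *\<^sub>R q \<in> P0_feasible d K"
    by (auto simp: P0_feasible_def sublevel_def)
qed

theorem proposition3p1:
  fixes K :: "(real ^ 'n::finite) set" and d :: nat
  assumes "compact K" and "d > 0" and "even d"
  shows "((\<exists>g. optimal_solution P0_objective (P0_feasible d K) g) \<longleftrightarrow>
          (\<exists>g. optimal_solution P_objective (P_feasible d K) g)) \<and>
         finite_dim_convex_problem (hom_polys d :: 'n rpoly set) P_objective (P_feasible d K)"
proof
  have "optimal_solution P_objective (P0_feasible d K) g \<longleftrightarrow>
        optimal_solution P0_objective (P0_feasible d K) g" for g
  proof (rule optimal_solution_cmult)
    show "0 < Gamma (1 + CARD('n) / d)"
      by (intro Gamma_real_pos add_pos_nonneg) simp_all
  qed (use \<open>d > 0\<close> in \<open>auto simp: P0_feasible_def P_objective_eq_Gamma_times_P0_objective\<close>)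
  then show "(\<exists>g. optimal_solution P0_objective (P0_feasible d K) g) \<longleftrightarrow>
             (\<exists>g. optimal_solution P_objective (P_feasible d K) g)"
    by (simp add: P_feasible_eq_P0_feasible)
  show "finite_dim_convex_problem (hom_polys d :: 'n rpoly set) P_objective (P_feasible d K)"
    unfolding finite_dim_convex_problem_def P_feasible_eq_P0_feasible
  proof (intro conjI)
    show "\<exists>B :: 'n rpoly set. finite B \<and> hom_polys d = span B"
      using hom_polys_eq_span finite_imageI[OF finite_mon_degree] by blast
    show "P0_feasible d K \<subseteq> hom_polys d" by (auto simp: P0_feasible_def)
  qed (simp_all add: subspace_hom_polys convex_P0_feasible ext_convex_on_P_objective
         subspace_imp_convex)
qed

end
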